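(* Let $p>n$ (with $p>2$), where $n$ is the dimension, and let $u_\varepsilon$ be a positive $p$-harmonious function in $\Omega\subset\mathbb{R}^n$ (with step size $\varepsilon$). Then $$\sup_{B_\rho(z_0)}u_\varepsilon\le C\inf_{B_\rho(z_0)}u_\varepsilon$$ for $B_{5\rho}(z_0)\subset\Omega$, with a constant $C$ independent of $u_\varepsilon$.
   Context: $B_\rho(x)$ denotes the open ball of radius $\rho$ centered at $x$ in $\mathbb{R}^n$. Fix $p>2$ and set $\alpha=\frac{p-2}{n+p}$, $\beta=\frac{n+2}{n+p}$, so $\alpha+\beta=1$. Let $\Omega\subset\mathbb{R}^n$ be a bounded domain, $\varepsilon>0$, $\Gamma_\varepsilon=\{x\in\mathbb{R}^n\setminus\Omega:\operatorname{dist}(x,\partial\Omega)\le\varepsilon\}$ and $\Omega_\varepsilon=\Omega\cup\Gamma_\varepsilon$. A $p$-harmonious function in $\Omega$ (with step size $\varepsilon$) is a Borel measurable function $u_\varepsilon:\Omega_\varepsilon\to\mathbb{R}$, with bounded Borel boundary values $F=u_\varepsilon|_{\Gamma_\varepsilon}$, that is the value of the tug-of-war with noise game with payoff $F$; equivalently, it is the unique Borel measurable function with boundary values $F$ on $\Gamma_\varepsilon$ satisfying the dynamic programming principle $$u_\varepsilon(x)=\frac{\alpha}{2}\Big\{\inf_{B_\varepsilon(x)}u_\varepsilon+\sup_{B_\varepsilon(x)}u_\varepsilon\Big\}+\frac{\beta}{|B_\varepsilon(x)|}\int_{B_\varepsilon(x)}u_\varepsilon\,dy\qquad\text{for all }x\in\Omega.$$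 In the game, a token at $x\in\Omega$ is moved as follows: with probability $\alpha$ a fair coin is tossed and the winning player moves the token to any point of $B_\varepsilon(x)$; with probability $\beta$ the token moves to a uniformly distributed random point of $B_\varepsilon(x)$. The game stops when the token first reaches $\Gamma_\varepsilon$, and Player II then pays Player I the value of $F$ at that point; Player I maximizes and Player II minimizes the expected payoff. The function is positive if $u_\varepsilon>0$ on $\Omega_\varepsilon$. *)

theory Defs
  imports "HOL-Analysis.Analysis"
begin

definition tug_alpha :: "real \<Rightarrow> nat \<Rightarrow> real" where
  "tug_alpha p n = (p - 2) / (real n + p)"

definition tug_beta :: "real \<Rightarrow> nat \<Rightarrow> real" where
  "tug_beta p n = (real n + 2) / (real n + p)"

definition boundary_strip :: "(real ^ 'n) set \<Rightarrow> real \<Rightarrow> (real ^ 'n) set" where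
  "boundary_strip \<Omega> \<epsilon> = {x. x \<notin> \<Omega> \<and> infdist x (frontier \<Omega>) \<le> \<epsilon>}"

definition extended_domain :: "(real ^ 'n) set \<Rightarrow> real \<Rightarrow> (real ^ 'n) set" where
  "extended_domain \<Omega> \<epsilon> = \<Omega> \<union> boundary_strip \<Omega> \<epsilon>"

definition bounded_domain :: "(real ^ 'n) set \<Rightarrow> bool" where
  "bounded_domain \<Omega> \<longleftrightarrow> open \<Omega> \<and> connected \<Omega> \<and> \<Omega> \<noteq> {} \<and> bounded \<Omega>"

text \<open>
  A p-harmonious function is the solution of the dynamic programming principle of
  tug-of-war with noise. Only its values on the extended domain matter. The principle
  asserts an equation between real numbers, so it includes that the supremum and the
  infimum over each ball are finite; without the explicit boundedness condition,
  Sup and Inf on the reals would take unspecified values. The balls centred in the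
  domain cover its closure, which is compact, so together with the boundedness of the
  boundary values this says that u is bounded on the extended domain.
\<close>

definition dynamic_programming ::
    "real \<Rightarrow> real \<Rightarrow> (real ^ 'n \<Rightarrow> real) \<Rightarrow> real ^ 'n \<Rightarrow> bool" where
  "dynamic_programming p \<epsilon> u x \<longleftrightarrow>
     bounded (u ` ball x \<epsilon>) \<and>
     u x = tug_alpha p CARD('n) / 2 * ((INF y\<in>ball x \<epsilon>. u y) + (SUP y\<in>ball x \<epsilon>. u y))
         + tug_beta p CARD('n) / measure lborel (ball x \<epsilon>)
             * set_lebesgue_integral lborel (ball x \<epsilon>) u"

definition p_harmonious ::
    "real \<Rightarrow> (real ^ 'n) set \<Rightarrow> real \<Rightarrow> (real ^ 'n \<Rightarrow> real) \<Rightarrow> bool" where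
  "p_harmonious p \<Omega> \<epsilon> u \<longleftrightarrow>
     u \<in> borel_measurable (restrict_space borel (extended_domain \<Omega> \<epsilon>)) \<and>
     bounded (u ` boundary_strip \<Omega> \<epsilon>) \<and>
     (\<forall>x\<in>\<Omega>. dynamic_programming p \<epsilon> u x)"

end

theory Submission
  imports Defs
begin

text \<open>
  The reason why the inequality holds is that for \<open>p > n\<close> single points have positive capacity:
  from \<open>x\<close>, Player I can steer the token into a ball of radius comparable to \<open>\<epsilon>\<close> around any
  given \<open>y\<close> with a probability that is bounded below independently of \<open>\<epsilon>\<close>. From there
  a bounded number of steps, each with probability \<open>\<alpha> / 2\<close>, leads to \<open>y\<close>. As \<open>u\<close> is
  positive, this yields \<open>c u(y) \<le> u(x)\<close>.

  The proof expresses this without the game, by a barrier. With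
  \<open>\<gamma> = (p - n) / (2 (p - 1))\<close>, the function \<open>|z|^\<gamma>\<close> is a strict supersolution of the dynamic
  programming principle at all points with \<open>|z| \<ge> K \<epsilon>\<close>, where \<open>K\<close> depends on \<open>n\<close> and \<open>p\<close>
  only (lemma \<open>norm_powr_strict_supersolution\<close>). Up to errors of third order in \<open>\<epsilon> / |z|\<close>,
  the principle sees the radial second derivative with weight \<open>\<alpha>\<close> and the Laplacian with weight
  \<open>\<beta> / (n + 2)\<close>, and these combine to the \<open>p\<close>-Laplacian, which is negative for this
  exponent. The exact second moments of the ball are essential here, because they
  determine the threshold \<open>p = n\<close>.

  Given \<open>x\<close> and \<open>y\<close> in the ball of radius \<open>\<rho>\<close>, a chain of boundedly many steps of the
  dynamic programming principle gives \<open>u \<ge> \<kappa>\<close> on the points of the ball of radius \<open>4 \<rho>\<close> around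
  \<open>y\<close> that have distance less than \<open>K \<epsilon>\<close> from \<open>y\<close>, where \<open>\<kappa>\<close> is a fixed multiple of
  \<open>u(y)\<close> (lemma \<open>p_harmonious_chain\<close>). Comparison with the strict subsolution
  \<open>\<kappa> (1 - (|z - y| / (4 \<rho>))^\<gamma>)\<close>, which is at most \<open>\<kappa>\<close> there and at most \<open>0 < u\<close> outside the
  ball, extends the lower bound to the ball (lemma \<open>p_harmonious_ge_power_barrier\<close>). As
  \<open>|x - y| < 2 \<rho>\<close>, the barrier at \<open>x\<close> is a fixed fraction of \<open>\<kappa>\<close>. Nothing in the argument
  compares \<open>\<epsilon>\<close> with \<open>\<rho>\<close>: if \<open>K \<epsilon>\<close> exceeds \<open>4 \<rho>\<close>, the chain alone covers the ball.
\<close>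

section \<open>Moments of the uniform distribution on a ball\<close>

lemma continuous_set_integrable_ball:
  fixes f :: "'a::euclidean_space \<Rightarrow> real"
  assumes "continuous_on UNIV f"
  shows "set_integrable lborel (ball x r) f"
proof -
  have "set_integrable lborel (cball x r) f"
    using assms unfolding set_integrable_def
    by (intro borel_integrable_compact) (auto intro: continuous_on_subset)
  then show ?thesis
    by (rule set_integrable_subset) auto
qed

lemma set_integral_sum:
  fixes f :: "'i \<Rightarrow> 'a \<Rightarrow> real"
  assumes "\<And>i. i \<in> I \<Longrightarrow> set_integrable M A (f i)"
  shows "(LINT x:A|M. \<Sum>i\<in>I. f i x) = (\<Sum>i\<in>I. LINT x:A|M. f i x)"
  using assms unfolding set_lebesgue_integral_def set_integrable_def
  by (simp add: sum_distrib_left integral_sum)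

lemma lborel_integral_affine:
  fixes f :: "'a::euclidean_space \<Rightarrow> real"
  assumes "c > 0" "f \<in> borel_measurable borel"
  shows "integral\<^sup>L lborel f = c ^ DIM('a) * (\<integral>x. f (t + c *\<^sub>R x) \<partial>lborel)"
proof -
  have "integral\<^sup>L lborel f
      = integral\<^sup>L (density (distr lborel borel (\<lambda>x. t + c *\<^sub>R x)) (\<lambda>_. \<bar>c\<bar> ^ DIM('a))) f"
    using lborel_affine[of c t] assms by simp
  also have "\<dots> = c ^ DIM('a) * (\<integral>x. f (t + c *\<^sub>R x) \<partial>lborel)"
    using assms by (subst integral_density) (auto simp: integral_distr)
  finally show ?thesis .
qed

lemma set_integral_ball_affine:
  fixes f :: "'a::euclidean_space \<Rightarrow> real"
  assumes "c > 0" "f \<in> borel_measurable borel"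
  shows "(LINT y:ball t (c * r)|lborel. f y) = c ^ DIM('a) * (LINT h:ball 0 r|lborel. f (t + c *\<^sub>R h))"
proof -
  have "indicator (ball t (c * r)) (t + c *\<^sub>R h) = (indicator (ball 0 r) h :: real)" for h
    using assms by (auto simp: indicator_def dist_norm)
  then show ?thesis
    unfolding set_lebesgue_integral_def
    using assms
    by (subst lborel_integral_affine[of c _ t])
       (auto intro!: borel_measurable_scaleR borel_measurable_indicator simp del: real_scaleR_def)
qed

text \<open>
  Stated for an abstract measure-preserving \<open>T\<close>: the symmetries that the moment
  computations use are the reflection at the origin, reflections of single coordinates and
  transpositions of two coordinates, which are obtained from \<open>lborel\<close> in different ways.
\<close>

lemma set_integral_ball_isometry:
  fixes f :: "'a::euclidean_space \<Rightarrow> real"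
  assumes "distr lborel borel T = lborel" "T \<in> borel_measurable borel"
    "\<And>h. norm (T h) = norm h" "f \<in> borel_measurable borel"
  shows "(LINT h:ball 0 r|lborel. f (T h)) = (LINT h:ball 0 r|lborel. f h)"
proof -
  have "(LINT h:ball 0 r|lborel. f h) = (\<integral>h. indicator (ball 0 r) h *\<^sub>R f h \<partial>distr lborel borel T)"
    unfolding set_lebesgue_integral_def using assms(1) by simp
  also have "\<dots> = (\<integral>h. indicator (ball 0 r) (T h) *\<^sub>R f (T h) \<partial>lborel)"
    using assms by (intro integral_distr borel_measurable_scaleR borel_measurable_indicator) auto
  also have "\<dots> = (LINT h:ball 0 r|lborel. f (T h))"
    unfolding set_lebesgue_integral_def using assms(3) by (auto simp: indicator_def)
  finally show ?thesis by simp
qed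

lemma lborel_distr_coordinate_reflection:
  fixes c :: "'a::euclidean_space \<Rightarrow> real"
  assumes "\<And>j. j \<in> Basis \<Longrightarrow> \<bar>c j\<bar> = 1"
  shows "distr lborel borel (\<lambda>x. \<Sum>j\<in>Basis. (c j * (x \<bullet> j)) *\<^sub>R j) = (lborel :: 'a measure)"
proof -
  have "c j \<noteq> 0" if "j \<in> Basis" for j using assms[OF that] by auto
  then have "(lborel :: 'a measure) = density (distr lborel borel
      (\<lambda>x. 0 + (\<Sum>j\<in>Basis. (c j * (x \<bullet> j)) *\<^sub>R j))) (\<lambda>_. (\<Prod>j\<in>Basis. \<bar>c j\<bar>))"
    by (rule lborel_affine_euclidean)
  also have "(\<Prod>j\<in>Basis. \<bar>c j\<bar>) = 1" using assms by simp
  finally show ?thesis by (simp add: density_1)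
qed

lemma lborel_distr_uminus_euclidean:
  "distr lborel borel uminus = (lborel :: 'a::euclidean_space measure)"
  using lborel_distr_coordinate_reflection[of "\<lambda>_::'a. -1 :: real"]
  by (simp add: sum_negf euclidean_representation)

text \<open>
  Preimages of boxes are boxes with permuted sides, and these have the same volume; boxes
  determine \<open>lborel\<close>.
\<close>

lemma lborel_distr_permute_coordinates:
  fixes \<pi> :: "'n::finite \<Rightarrow> 'n"
  assumes "bij \<pi>"
  shows "distr lborel borel (\<lambda>x. \<chi> i. x $ \<pi> i) = (lborel :: (real^'n) measure)"
proof -
  let ?T = "\<lambda>x::real^'n. \<chi> i. x $ \<pi> i"
  let ?U = "\<lambda>x::real^'n. \<chi> i. x $ inv \<pi> i"
  have meas: "?T \<in> borel_measurable borel"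
    by (intro borel_measurable_continuous_onI continuous_intros)
  have vol: "emeasure lborel (box l u) = ennreal (\<Prod>i\<in>UNIV. u $ i - l $ i)"
    if "\<And>i. l $ i \<le> u $ i" for l u :: "real^'n"
  proof -
    have le: "l \<bullet> b \<le> u \<bullet> b" if "b \<in> Basis" for b
      using that \<open>\<And>i. l $ i \<le> u $ i\<close> by (auto simp: Basis_vec_def inner_axis)
    have "emeasure lborel (box l u) = ennreal (measure lborel (cbox l u))"
      using le by (subst emeasure_lborel_box) (auto simp: content_cbox)
    also have "measure lborel (cbox l u) = (\<Prod>i\<in>UNIV. u $ i - l $ i)"
    proof (rule content_cbox_cart)
      have "l \<in> cbox l u" using that by (simp add: mem_box_cart)
      then show "cbox l u \<noteq> {}" by auto
    qed
    finally show ?thesis .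
  qed
  have "lborel = distr lborel borel ?T"
  proof (rule lborel_eqI)
    fix l u :: "real^'n" assume le: "\<And>b. b \<in> Basis \<Longrightarrow> l \<bullet> b \<le> u \<bullet> b"
    have le': "l $ i \<le> u $ i" for i
      using le[of "axis i 1"] by (simp add: inner_axis axis_in_Basis_iff)
    have pre: "?T -` box l u \<inter> space lborel = box (?U l) (?U u)"
      using assms by (auto simp: mem_box_cart bij_is_surj bij_is_inj surj_f_inv_f inv_f_f)
        (metis assms bij_inv_eq_iff)+
    have "emeasure (distr lborel borel ?T) (box l u) = emeasure lborel (box (?U l) (?U u))"
      using meas pre by (subst emeasure_distr) auto
    also have "\<dots> = ennreal (\<Prod>i\<in>UNIV. u $ inv \<pi> i - l $ inv \<pi> i)"
      using le' by (subst vol) auto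
    also have "(\<Prod>i\<in>UNIV. u $ inv \<pi> i - l $ inv \<pi> i) = (\<Prod>i\<in>UNIV. u $ i - l $ i)"
      using prod.reindex_bij_betw[of "inv \<pi>" UNIV UNIV "\<lambda>i. u $ i - l $ i"] bij_imp_bij_inv[OF assms]
      by simp
    also have "ennreal \<dots> = emeasure lborel (box l u)" using vol le' by simp
    also have "\<dots> = (\<Prod>b\<in>Basis. (u - l) \<bullet> b)" using le by (subst emeasure_lborel_box) auto
    finally show "emeasure (distr lborel borel ?T) (box l u) = (\<Prod>b\<in>Basis. (u - l) \<bullet> b)" .
  qed simp
  then show ?thesis by simp
qed

lemma set_integral_ball_inner:
  fixes x :: "'a::euclidean_space"
  shows "(LINT h:ball 0 r|lborel. x \<bullet> h) = 0"
proof -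
  have "(LINT h:ball 0 r|lborel. x \<bullet> (- h)) = (LINT h:ball 0 r|lborel. x \<bullet> h)"
    using set_integral_ball_isometry[OF lborel_distr_uminus_euclidean, of "\<lambda>h. x \<bullet> h" r] by simp
  then show ?thesis by (simp add: set_integral_uminus continuous_set_integrable_ball continuous_intros)
qed

text \<open>
  Let \<open>F s\<close> be the integral of \<open>|h|^2\<close> over the ball of radius \<open>s r\<close>. By scaling,
  \<open>F s = s^(n+2) F 1\<close>, so its derivative at \<open>1\<close> is \<open>(n + 2) F 1\<close>. On the other hand, the thin
  shell between the radii \<open>s r\<close> and \<open>r\<close> has volume about \<open>n (1 - s) V\<close>, and \<open>|h|^2\<close> is close to
  \<open>r^2\<close> on it, so the derivative is \<open>n r^2 V\<close>. The proof bounds the integral over the shell from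
  both sides, divides by \<open>1 - s\<close> and lets \<open>s\<close> tend to \<open>1\<close> from the left.
\<close>

lemma set_integral_ball_norm_squared:
  fixes r :: real
  assumes "r > 0"
  shows "(real DIM('a::euclidean_space) + 2) * (LINT h:ball 0 r|lborel. (norm (h::'a))\<^sup>2)
    = real DIM('a) * r\<^sup>2 * measure lborel (ball (0::'a) r)"
proof -
  define F V where "F = (LINT h:ball 0 r|lborel. (norm (h::'a))\<^sup>2)"
    and "V = measure lborel (ball (0::'a) r)"
  let ?n = "DIM('a)"
  have int: "set_integrable lborel (ball 0 s) (\<lambda>h::'a. (norm h)\<^sup>2)" for s
    by (intro continuous_set_integrable_ball continuous_intros)
  have squeeze: "s\<^sup>2 * r\<^sup>2 * V * (\<Sum>i<?n. s ^ i) \<le> F * (\<Sum>i<?n+2. s ^ i) \<and>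
      F * (\<Sum>i<?n+2. s ^ i) \<le> r\<^sup>2 * V * (\<Sum>i<?n. s ^ i)" if s: "0 < s" "s < 1" for s :: real
  proof -
    let ?A = "ball (0::'a) r - ball 0 (s * r)"
    have sub: "ball (0::'a) (s * r) \<subseteq> ball 0 r"
      using s assms by (intro subset_ball) (simp add: mult_left_le_one_le)
    have inti: "set_integrable lborel ?A (\<lambda>h::'a. (norm h)\<^sup>2)"
      by (rule set_integrable_subset[OF int[of r]]) auto
    have scale: "(LINT h:ball 0 (s * r)|lborel. (norm (h::'a))\<^sup>2) = s ^ (?n + 2) * F"
    proof -
      have "(LINT h:ball 0 (s * r)|lborel. (norm (h::'a))\<^sup>2)
          = s ^ ?n * (LINT h:ball 0 r|lborel. s\<^sup>2 * (norm (h::'a))\<^sup>2)"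
        using s by (subst set_integral_ball_affine) (auto simp: power_mult_distrib)
      then show ?thesis by (simp add: F_def power_add power2_eq_square)
    qed
    have mA: "measure lborel ?A = V - s ^ ?n * V"
    proof -
      have "measure lborel ?A = V - measure lborel (ball (0::'a) (s * r))"
        unfolding V_def using sub emeasure_lborel_ball_finite[of "0::'a" r] by (intro measure_Diff) auto
      then show ?thesis
        using assms s by (simp add: V_def content_ball power_mult_distrib)
    qed
    have "F = (LINT h:ball 0 (s * r) \<union> ?A|lborel. (norm (h::'a))\<^sup>2)"
      unfolding F_def using sub by (simp add: Un_absorb1)
    \<comment> \<open>Scaling of the inner ball turns the integral over the shell into a multiple of \<open>F\<close>.\<close>
    also have "\<dots> = s ^ (?n + 2) * F + (LINT h:?A|lborel. (norm (h::'a))\<^sup>2)"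
      using int inti by (subst set_integral_Un) (auto simp: scale)
    finally have A: "(LINT h:?A|lborel. (norm (h::'a))\<^sup>2) = F * (1 - s ^ (?n + 2))"
      by (simp add: algebra_simps)
    have fin: "emeasure lborel ?A < \<infinity>"
      by (rule le_less_trans[OF emeasure_mono emeasure_lborel_ball_finite[of 0 r]]) auto
    have cst: "set_integrable lborel ?A (\<lambda>h::'a. c)" "(LINT h:?A|lborel. c) = c * (V - s ^ ?n * V)" for c :: real
      using fin mA by (auto simp: set_integrable_def set_lebesgue_integral_def)
    have "(LINT h:?A|lborel. (s * r)\<^sup>2) \<le> (LINT h:?A|lborel. (norm (h::'a))\<^sup>2)"
      using s assms by (intro set_integral_mono cst inti power_mono) auto
    moreover have "(LINT h:?A|lborel. (norm (h::'a))\<^sup>2) \<le> (LINT h:?A|lborel. r\<^sup>2)"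
      using s assms by (intro set_integral_mono cst inti power_mono) auto
    ultimately have "s\<^sup>2 * r\<^sup>2 * V * (1 - s ^ ?n) \<le> F * (1 - s ^ (?n + 2))"
      "F * (1 - s ^ (?n + 2)) \<le> r\<^sup>2 * V * (1 - s ^ ?n)"
      unfolding cst(2) A by (auto simp: algebra_simps power_mult_distrib)
    moreover have geo: "1 - s ^ k = (1 - s) * (\<Sum>i<k. s ^ i)" for k
      by (simp add: one_diff_power_eq)
    ultimately have "(1 - s) * (s\<^sup>2 * r\<^sup>2 * V * (\<Sum>i<?n. s ^ i)) \<le> (1 - s) * (F * (\<Sum>i<?n+2. s ^ i))"
      "(1 - s) * (F * (\<Sum>i<?n+2. s ^ i)) \<le> (1 - s) * (r\<^sup>2 * V * (\<Sum>i<?n. s ^ i))"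
      unfolding geo by (simp_all only: mult.assoc mult.left_commute[of _ "1 - s"])
    then show ?thesis using s by simp
  qed
  \<comment> \<open>The squeeze holds for \<open>s < 1\<close>; in the limit both geometric sums count their terms.\<close>
  have ev: "eventually (\<lambda>s::real. 0 < s \<and> s < 1) (at_left 1)"
    by (rule eventually_at_leftI[of 0]) auto
  have lim: "((\<lambda>s::real. \<Sum>i<k. s ^ i) \<longlongrightarrow> (\<Sum>i<k. 1 ^ i)) (at_left 1)" for k
    by (intro tendsto_intros)
  have lim2: "((\<lambda>s::real. s\<^sup>2 * r\<^sup>2 * V) \<longlongrightarrow> 1\<^sup>2 * r\<^sup>2 * V) (at_left 1)"
    by (intro tendsto_intros)
  have "1\<^sup>2 * r\<^sup>2 * V * (\<Sum>i<?n. 1 ^ i) \<le> F * (\<Sum>i<?n+2. 1 ^ i)"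
    by (rule tendsto_le[OF _ tendsto_mult[OF tendsto_const lim] tendsto_mult[OF lim2 lim]])
       (use squeeze in \<open>auto intro!: eventually_mono[OF ev]\<close>)
  moreover have "F * (\<Sum>i<?n+2. 1 ^ i) \<le> r\<^sup>2 * V * (\<Sum>i<?n. 1 ^ i)"
    by (rule tendsto_le[OF _ tendsto_mult[OF tendsto_const lim] tendsto_mult[OF tendsto_const lim]])
       (use squeeze in \<open>auto intro!: eventually_mono[OF ev]\<close>)
  ultimately show ?thesis unfolding F_def V_def by (simp add: algebra_simps)
qed

text \<open>
  The integrand is odd under the reflection of the \<open>i\<close>-th coordinate.
\<close>

lemma set_integral_ball_coordinate_product:
  fixes i j :: "'n::finite"
  assumes "i \<noteq> j"
  shows "(LINT h:ball 0 r|lborel. (h::real^'n) $ i * h $ j) = 0"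
proof -
  \<comment> \<open>The reflection of the \<open>i\<close>-th coordinate, written in the basis as a diagonal map.\<close>
  define T where "T = (\<lambda>x::real^'n. \<Sum>b\<in>Basis. ((if b = axis i 1 then -1 else 1) * (x \<bullet> b)) *\<^sub>R b)"
  have T: "T h \<bullet> b = (if b = axis i 1 then -1 else 1) * (h \<bullet> b)" if "b \<in> Basis" for h b
    unfolding T_def using that by (simp add: inner_sum_left inner_Basis if_distrib cong: if_cong)
  have Ti: "T h $ i = - (h $ i)" "T h $ j = h $ j" for h
    using T[of "axis i 1" h] T[of "axis j 1" h] assms
    by (auto simp: inner_axis axis_in_Basis_iff axis_eq_axis)
  have "norm (T h) = norm h" for h
    unfolding norm_eq_sqrt_inner by (subst (1 2) euclidean_inner) (auto intro!: sum.cong simp: T)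
  moreover have "distr lborel borel T = lborel"
    unfolding T_def by (rule lborel_distr_coordinate_reflection) auto
  moreover have "T \<in> borel_measurable borel"
    unfolding T_def by (intro borel_measurable_continuous_onI continuous_intros)
  ultimately have "(LINT h:ball 0 r|lborel. T h $ i * T h $ j) = (LINT h:ball 0 r|lborel. h $ i * h $ j)"
    by (intro set_integral_ball_isometry[where f = "\<lambda>h. h $ i * h $ j"])
       (auto intro!: borel_measurable_continuous_onI continuous_intros)
  then show ?thesis unfolding Ti
    by (simp add: set_integral_uminus continuous_set_integrable_ball continuous_intros)
qed

text \<open>
  Transposing coordinates shows that all coordinates have the same second moment, so each has
  the \<open>n\<close>-th part of the integral of \<open>|h|^2\<close>.
\<close>

lemma set_integral_ball_coordinate_squared:
  fixes i :: "'n::finite"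
  assumes "r > 0"
  shows "(LINT h:ball 0 r|lborel. (h::real^'n) $ i * h $ i)
    = r\<^sup>2 / (real CARD('n) + 2) * measure lborel (ball (0::real^'n) r)"
proof -
  let ?I = "\<lambda>i. LINT h:ball 0 r|lborel. (h::real^'n) $ i * h $ i"
  have eq: "?I j = ?I i" for j
  proof -
    let ?T = "\<lambda>h::real^'n. \<chi> k. h $ (Transposition.transpose i j) k"
    have "norm (?T h) = norm h" for h
      unfolding norm_vec_def L2_set_def
      using sum.reindex_bij_betw[of "Transposition.transpose i j" UNIV UNIV "\<lambda>k. (norm (h $ k))\<^sup>2"] by simp
    then have "(LINT h:ball 0 r|lborel. ?T h $ i * ?T h $ i) = ?I i"
      by (intro set_integral_ball_isometry[where f = "\<lambda>h. h $ i * h $ i"] lborel_distr_permute_coordinates)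
         (auto intro!: borel_measurable_continuous_onI continuous_intros)
    then show ?thesis by simp
  qed
  have "(LINT h:ball 0 r|lborel. (norm (h::real^'n))\<^sup>2) = (\<Sum>j\<in>UNIV. ?I j)"
    by (subst set_integral_sum[symmetric])
       (auto intro!: continuous_set_integrable_ball continuous_intros
         simp: power2_norm_eq_inner inner_vec_def)
  also have "\<dots> = (\<Sum>j\<in>(UNIV::'n set). ?I i)"
    by (intro sum.cong refl eq)
  finally have "(LINT h:ball 0 r|lborel. (norm (h::real^'n))\<^sup>2) = real CARD('n) * ?I i"
    by simp
  with set_integral_ball_norm_squared[OF assms, where ?'a = "real^'n"]
  have "real CARD('n) * ((real CARD('n) + 2) * ?I i)
      = real CARD('n) * (r\<^sup>2 * measure lborel (ball (0::real^'n) r))"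
    by (simp add: algebra_simps)
  then have "(real CARD('n) + 2) * ?I i = r\<^sup>2 * measure lborel (ball (0::real^'n) r)"
    by simp
  then show ?thesis by (simp add: field_simps)
qed

lemma set_integral_ball_inner_squared:
  fixes x :: "real^'n"
  assumes "r > 0"
  shows "(LINT h:ball 0 r|lborel. (x \<bullet> h)\<^sup>2)
    = (norm x)\<^sup>2 * r\<^sup>2 / (real CARD('n) + 2) * measure lborel (ball (0::real^'n) r)"
proof -
  have int: "set_integrable lborel (ball 0 r) (\<lambda>h::real^'n. c * (h $ i * h $ j))" for c i j
    by (intro continuous_set_integrable_ball continuous_intros)
  have "(LINT h:ball 0 r|lborel. (x \<bullet> h)\<^sup>2)
      = (LINT h:ball 0 r|lborel. (\<Sum>i\<in>UNIV. \<Sum>j\<in>UNIV. (x $ i * x $ j) * (h $ i * h $ j)))"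
    by (simp add: inner_vec_def power2_eq_square sum_product algebra_simps)
  also have "\<dots> = (\<Sum>i\<in>UNIV. \<Sum>j\<in>UNIV. (x $ i * x $ j) * (LINT h:ball 0 r|lborel. (h::real^'n) $ i * h $ j))"
    using int by (subst set_integral_sum;
      intro sum.cong continuous_set_integrable_ball continuous_intros refl)
      (subst set_integral_sum; simp add: continuous_set_integrable_ball continuous_intros)
  also have "\<dots> = (\<Sum>i\<in>UNIV. (x $ i * x $ i) * (r\<^sup>2 / (real CARD('n) + 2) * measure lborel (ball (0::real^'n) r)))"
  proof (intro sum.cong refl)
    fix i
    show "(\<Sum>j\<in>UNIV. (x $ i * x $ j) * (LINT h:ball 0 r|lborel. (h::real^'n) $ i * h $ j))
      = (x $ i * x $ i) * (r\<^sup>2 / (real CARD('n) + 2) * measure lborel (ball (0::real^'n) r))"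
      using assms by (subst sum.remove[of _ i])
        (auto simp: set_integral_ball_coordinate_squared set_integral_ball_coordinate_product intro!: sum.neutral)
  qed
  also have "\<dots> = (norm x)\<^sup>2 * r\<^sup>2 / (real CARD('n) + 2) * measure lborel (ball (0::real^'n) r)"
    by (simp add: power2_norm_eq_inner inner_vec_def sum_distrib_right sum_divide_distrib mult.assoc)
  finally show ?thesis .
qed

section \<open>Taylor bounds for powers\<close>

lemma powr_ge_tangent_at_1:
  fixes a s :: real
  assumes "a \<le> 0" "s > 0"
  shows "s powr a \<ge> 1 + a * (s - 1)"
proof -
  have "a * 1 powr (a - 1) * (s - 1) \<le> s powr a - 1 powr a"
  proof (rule f''_imp_f'[where C = "{0<..}" and f' = "\<lambda>x. a * x powr (a - 1)"
        and f'' = "\<lambda>x. a * ((a - 1) * x powr (a - 2))"])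
    fix x :: real assume "x \<in> {0<..}"
    then have x: "x > 0" by simp
    show "((\<lambda>x. x powr a) has_real_derivative a * x powr (a - 1)) (at x)"
      "((\<lambda>x. a * x powr (a - 1)) has_real_derivative a * ((a - 1) * x powr (a - 2))) (at x)"
      using has_real_derivative_powr[OF x, of a] has_real_derivative_powr[OF x, of "a - 1"]
      by (auto intro!: DERIV_cmult)
    show "0 \<le> a * ((a - 1) * x powr (a - 2))"
      using assms by (intro mult_nonpos_nonpos mult_nonpos_nonneg) auto
  qed (use assms in auto)
  then show ?thesis by simp
qed

text \<open>
  The right-hand side is the third-order Taylor polynomial. A cubic bound is what the barrier
  needs: it is exact up to the second order, which decides the sign, and its odd terms cancel in
  symmetric sums. The second derivative of the difference is \<open>q (1 - q)\<close> times the gap between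
  \<open>s powr (q - 2)\<close> and its tangent at \<open>1\<close>, so the difference is convex; it vanishes to first
  order at \<open>1\<close>.
\<close>

lemma powr_le_cubic_at_1:
  fixes q s :: real
  assumes "0 \<le> q" "q \<le> 1" "s > 0"
  shows "s powr q \<le> 1 + q * (s - 1) - q * (1 - q) / 2 * (s - 1)\<^sup>2 + q * (1 - q) * (2 - q) / 6 * (s - 1) ^ 3"
proof -
  define f where "f = (\<lambda>s. 1 + q * (s - 1) - q * (1 - q) / 2 * (s - 1)\<^sup>2
    + q * (1 - q) * (2 - q) / 6 * (s - 1) ^ 3 - s powr q)"
  define f' where "f' = (\<lambda>s. q - q * (1 - q) * (s - 1)
    + q * (1 - q) * (2 - q) / 2 * (s - 1)\<^sup>2 - q * s powr (q - 1))"
  define f'' where "f'' = (\<lambda>s. q * (1 - q) * (s powr (q - 2) - (1 + (q - 2) * (s - 1))))"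
  have "f' 1 * (s - 1) \<le> f s - f 1"
  proof (rule f''_imp_f'[where C = "{0<..}" and f'' = f''])
    fix x :: real assume x: "x \<in> {0<..}"
    show "(f has_real_derivative f' x) (at x)"
      unfolding f_def f'_def using x
      by (auto intro!: derivative_eq_intros has_real_derivative_powr simp: field_simps power2_eq_square)
    have "((\<lambda>s. s powr (q - 1)) has_real_derivative (q - 1) * x powr (q - 1 - 1)) (at x)"
      using x by (intro has_real_derivative_powr) auto
    then have d: "((\<lambda>s. s powr (q - 1)) has_real_derivative (q - 1) * x powr (q - 2)) (at x)"
      by simp
    show "(f' has_real_derivative f'' x) (at x)"
      unfolding f'_def f''_def using x
      by (auto intro!: derivative_eq_intros d simp: field_simps)
    show "f'' x \<ge> 0"
      unfolding f''_def using powr_ge_tangent_at_1[of "q - 2" x] assms x by auto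
  qed (use assms in auto)
  then show ?thesis by (simp add: f_def f'_def)
qed

lemma powr_symmetric_le:
  fixes \<gamma> e :: real
  assumes "0 < \<gamma>" "\<gamma> < 1" "0 \<le> e" "e < 1"
  shows "(1 + e) powr \<gamma> + (1 - e) powr \<gamma> \<le> 2 - \<gamma> * (1 - \<gamma>) * e\<^sup>2"
  using powr_le_cubic_at_1[of \<gamma> "1 + e"] powr_le_cubic_at_1[of \<gamma> "1 - e"] assms
  by (simp add: power3_eq_cube)

text \<open>
  Write \<open>|x + h|^2 = |x|^2 (1 + t)\<close> and apply the cubic bound with exponent \<open>\<gamma> / 2\<close>. Only terms
  whose averages over a ball are known survive; everything else is at most a multiple of \<open>e^3\<close>.
\<close>

lemma norm_add_powr_le:
  fixes x h :: "'a::real_inner" and e \<gamma> :: real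
  assumes \<gamma>: "0 < \<gamma>" "\<gamma> < 1" and "x \<noteq> 0" "norm h \<le> e * norm x" "0 \<le> e" "e < 1"
  shows "norm (x + h) powr \<gamma> \<le> norm x powr \<gamma> *
    (1 + \<gamma> / 2 * (2 * (x \<bullet> h) + (norm h)\<^sup>2) / (norm x)\<^sup>2
       - \<gamma> * (1 - \<gamma> / 2) * (x \<bullet> h)\<^sup>2 / norm x ^ 4 + 6 * \<gamma> * e ^ 3)"
proof -
  define a b q t where "a = (x \<bullet> h) / (norm x)\<^sup>2" and "b = (norm h / norm x)\<^sup>2"
    and "q = \<gamma> / 2" and "t = 2 * a + b"
  have r: "norm x > 0" using assms by simp
  have "norm h / norm x \<le> e" using assms r by (simp add: field_simps)
  then have b: "0 \<le> b" "b \<le> e\<^sup>2" unfolding b_def using r by (auto intro!: power_mono)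
  have "\<bar>x \<bullet> h\<bar> \<le> norm x * norm h" by (rule Cauchy_Schwarz_ineq2)
  also have "\<dots> \<le> norm x * (e * norm x)" using assms by (intro mult_left_mono) auto
  finally have a: "\<bar>a\<bar> \<le> e" unfolding a_def using r by (simp add: field_simps power2_eq_square)
  have "e\<^sup>2 \<le> e" using assms by (simp add: power2_eq_square mult_left_le_one_le)
  \<comment> \<open>From here \<open>t^3 \<le> 27 e^3\<close>, the source of the constant \<open>9\<close> below.\<close>
  then have t: "\<bar>t\<bar> \<le> 3 * e" unfolding t_def using a b by linarith
  have sq: "(norm (x + h) / norm x)\<^sup>2 = 1 + t"
  proof -
    have "(norm (x + h))\<^sup>2 = (norm x)\<^sup>2 + 2 * (x \<bullet> h) + (norm h)\<^sup>2"
      by (simp add: power2_norm_eq_inner algebra_simps inner_commute)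
    then show ?thesis using r unfolding t_def a_def b_def
      by (simp add: power_divide add_divide_distrib)
  qed
  have "e * norm x < 1 * norm x" using assms r by (intro mult_strict_right_mono) auto
  then have "norm h < norm x" using assms(4) by linarith
  then have pos: "norm (x + h) > 0"
    using norm_triangle_ineq2[of x "- h"] by auto
  have q: "0 < q" "q < 1" using \<gamma> by (auto simp: q_def)
  have "norm (x + h) powr \<gamma> = norm x powr \<gamma> * (norm (x + h) / norm x) powr \<gamma>"
    using r pos by (simp add: powr_divide)
  also have "(norm (x + h) / norm x) powr \<gamma> = (1 + t) powr q"
    unfolding sq[symmetric] q_def using r pos by (simp add: powr_powr flip: powr_numeral)
  also have "(1 + t) powr q \<le> 1 + q * t - q * (1 - q) / 2 * t\<^sup>2 + q * (1 - q) * (2 - q) / 6 * t ^ 3"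
  proof -
    have "1 + t > 0" unfolding sq[symmetric] using r pos by simp
    then show ?thesis using powr_le_cubic_at_1[of q "1 + t"] q by simp
  qed
  also have "q * (1 - q) * (2 - q) / 6 * t ^ 3 \<le> 9 * q * e ^ 3"
  proof -
    have "t ^ 3 \<le> \<bar>t\<bar> ^ 3" by (metis abs_ge_self power_abs)
    also have "\<dots> \<le> (3 * e) ^ 3" using t by (intro power_mono) auto
    finally have "t ^ 3 \<le> 27 * e ^ 3" by (simp add: power_mult_distrib)
    then have "q * (1 - q) * (2 - q) / 6 * t ^ 3 \<le> q * (1 - q) * (2 - q) / 6 * (27 * e ^ 3)"
      using q by (intro mult_left_mono) auto
    also have "\<dots> = ((1 - q) * (2 - q)) * (9 / 2 * q * e ^ 3)" by simp
    also have "\<dots> \<le> 2 * (9 / 2 * q * e ^ 3)"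
    proof (rule mult_right_mono)
      have "(1 - q) * (2 - q) \<le> 1 * 2" using q by (intro mult_mono) auto
      then show "(1 - q) * (2 - q) \<le> 2" by simp
    qed (use q assms in auto)
    finally show ?thesis by simp
  qed
  \<comment> \<open>In \<open>t^2 = 4 a^2 + 4 a b + b^2\<close> only \<open>4 a^2\<close> has order \<open>e^2\<close>.\<close>
  also have "1 + q * t - q * (1 - q) / 2 * t\<^sup>2 \<le> 1 + q * t - q * (1 - q) / 2 * (4 * a\<^sup>2 - 4 * e ^ 3)"
  proof -
    have "\<bar>a\<bar> * b \<le> e * e\<^sup>2" using a b assms by (intro mult_mono) auto
    moreover have "- a * b \<le> \<bar>a\<bar> * b" using b by (intro mult_right_mono) auto
    ultimately have "- (a * b) \<le> e ^ 3" by (simp add: power3_eq_cube power2_eq_square)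
    moreover have "t\<^sup>2 = 4 * a\<^sup>2 + 4 * (a * b) + b\<^sup>2"
      unfolding t_def by (simp add: power2_eq_square algebra_simps)
    ultimately have "4 * a\<^sup>2 - 4 * e ^ 3 \<le> t\<^sup>2"
      using zero_le_power2[of b] by linarith
    then show ?thesis using q by (intro diff_left_mono mult_left_mono) auto
  qed
  also have "1 + q * t - q * (1 - q) / 2 * (4 * a\<^sup>2 - 4 * e ^ 3) + 9 * q * e ^ 3
      = 1 + q * t - 2 * q * (1 - q) * a\<^sup>2 + (9 + 2 * (1 - q)) * (q * e ^ 3)"
    by (simp add: field_simps)
  also have "\<dots> \<le> 1 + q * t - 2 * q * (1 - q) * a\<^sup>2 + 12 * (q * e ^ 3)"
    using q assms by (intro add_left_mono mult_right_mono) auto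
  also have "\<dots> = 1 + \<gamma> / 2 * (2 * (x \<bullet> h) + (norm h)\<^sup>2) / (norm x)\<^sup>2
       - \<gamma> * (1 - \<gamma> / 2) * (x \<bullet> h)\<^sup>2 / norm x ^ 4 + 6 * \<gamma> * e ^ 3"
    unfolding q_def t_def a_def b_def using r
    by (simp add: power_divide add_divide_distrib distrib_left power_even_eq[of _ 2, simplified])
  finally show ?thesis using r by (simp add: mult_left_mono)
qed

text \<open>
  The first-order term averages to zero and the two second-order terms are given by the second
  moments, which contribute \<open>n\<close> and \<open>\<gamma> - 2\<close> to the coefficient of \<open>e^2\<close>, where \<open>e = \<epsilon> / |x|\<close>.
\<close>

lemma mean_norm_powr_le:
  fixes x :: "real^'n" and \<gamma> \<epsilon> :: real
  assumes \<gamma>: "0 < \<gamma>" "\<gamma> < 1" and \<epsilon>: "0 < \<epsilon>" "\<epsilon> < norm x"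
  shows "(LINT h:ball 0 \<epsilon>|lborel. norm (x + h) powr \<gamma>) / measure lborel (ball (0::real^'n) \<epsilon>)
    \<le> norm x powr \<gamma> * (1 + \<gamma> / 2 * ((real CARD('n) - 2 + \<gamma>) / (real CARD('n) + 2)) * (\<epsilon> / norm x)\<^sup>2
          + 6 * \<gamma> * (\<epsilon> / norm x) ^ 3)"
proof -
  define e r V where "e = \<epsilon> / norm x" and "r = norm x" and "V = measure lborel (ball (0::real^'n) \<epsilon>)"
  let ?n = "real CARD('n)"
  have r: "r > 0" "\<epsilon> = e * r" "x \<noteq> 0" using \<epsilon> by (auto simp: r_def e_def)
  have e: "0 < e" "e < 1" using \<epsilon> r(1) unfolding e_def r_def by (auto simp: field_simps)
  have V: "V > 0" using \<epsilon> by (simp add: V_def)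
  let ?B = "ball (0::real^'n) \<epsilon>"
  let ?g = "\<lambda>h. 1 + 6 * \<gamma> * e ^ 3 + \<gamma> / r\<^sup>2 * (x \<bullet> h) + \<gamma> / (2 * r\<^sup>2) * (norm h)\<^sup>2
       - \<gamma> * (1 - \<gamma> / 2) / r ^ 4 * (x \<bullet> h)\<^sup>2"
  have int: "set_integrable lborel ?B f" if "continuous_on UNIV f" for f :: "_ \<Rightarrow> real"
    using that by (rule continuous_set_integrable_ball)
  have cont: "continuous_on UNIV ?g" by (intro continuous_intros)
  have contp: "continuous_on UNIV (\<lambda>h. norm (x + h) powr \<gamma>)"
    using \<gamma> by (intro continuous_on_powr' continuous_intros) auto
  have cst: "(LINT h:?B|lborel. c) = c * V" for c :: real
    unfolding V_def using emeasure_lborel_ball_finite[of "0::real^'n" \<epsilon>]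
    by (simp add: set_lebesgue_integral_def)
  have norm2: "(LINT h:?B|lborel. (norm h)\<^sup>2) = ?n * \<epsilon>\<^sup>2 * V / (?n + 2)"
    using set_integral_ball_norm_squared[OF \<epsilon>(1), where ?'a = "real^'n"]
    unfolding V_def by (simp add: field_simps)
  have "(LINT h:?B|lborel. norm (x + h) powr \<gamma>) \<le> (LINT h:?B|lborel. r powr \<gamma> * ?g h)"
  proof (rule set_integral_mono)
    fix h assume "h \<in> ?B"
    then show "norm (x + h) powr \<gamma> \<le> r powr \<gamma> * ?g h"
      using norm_add_powr_le[OF \<gamma>, of x h e] r e unfolding r_def
      by (simp add: algebra_simps add_divide_distrib)
  qed (intro int contp continuous_on_mult continuous_on_const cont)+
  also have "\<dots> = r powr \<gamma> * (LINT h:?B|lborel. ?g h)" by simp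
  also have "(LINT h:?B|lborel. ?g h) = (1 + 6 * \<gamma> * e ^ 3) * V + 0
      + \<gamma> / (2 * r\<^sup>2) * (?n * \<epsilon>\<^sup>2 * V / (?n + 2))
      - \<gamma> * (1 - \<gamma> / 2) / r ^ 4 * (r\<^sup>2 * \<epsilon>\<^sup>2 / (?n + 2) * V)"
    by (simp only: set_integral_diff(2) set_integral_add(2) int continuous_intros
          set_integral_mult_right cst set_integral_ball_inner norm2
          set_integral_ball_inner_squared[OF \<epsilon>(1)] r_def[symmetric] V_def[symmetric] mult_zero_right)
  also have "\<dots> = V * (1 + \<gamma> / 2 * ((?n - 2 + \<gamma>) / (?n + 2)) * e\<^sup>2 + 6 * \<gamma> * e ^ 3)"
  proof -
    define j where "j = 1 / (?n + 2)"
    define k where "k = \<gamma> / 2"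
    have \<gamma>_eq: "\<gamma> = 2 * k" by (simp add: k_def)
    have "\<gamma> / (2 * r\<^sup>2) * (?n * \<epsilon>\<^sup>2 * V / (?n + 2)) = \<gamma> / 2 * ?n * e\<^sup>2 * V * j"
      using r(1) unfolding r(2) j_def by (simp add: power_mult_distrib)
    moreover have "\<gamma> * (1 - \<gamma> / 2) / r ^ 4 * (r\<^sup>2 * \<epsilon>\<^sup>2 / (?n + 2) * V) = \<gamma> * (1 - \<gamma> / 2) * e\<^sup>2 * V * j"
    proof -
      define R where "R = r\<^sup>2"
      have "r ^ 4 = R * R" "R > 0" using r(1) by (simp_all add: R_def)
      then show ?thesis unfolding r(2) j_def power_mult_distrib R_def[symmetric] by simp
    qed
    moreover have "(?n - 2 + \<gamma>) / (?n + 2) = (?n - 2 + \<gamma>) * j" by (simp add: j_def)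
    moreover have "(1 + 6 * \<gamma> * e ^ 3) * V + 0 + \<gamma> / 2 * ?n * e\<^sup>2 * V * j - \<gamma> * (1 - \<gamma> / 2) * e\<^sup>2 * V * j
        = V * (1 + \<gamma> / 2 * ((?n - 2 + \<gamma>) * j) * e\<^sup>2 + 6 * \<gamma> * e ^ 3)"
      unfolding \<gamma>_eq by (simp add: algebra_simps)
    ultimately show ?thesis by (simp only:)
  qed
  finally have bound: "(LINT h:?B|lborel. norm (x + h) powr \<gamma>) \<le> r powr \<gamma> *
      (V * (1 + \<gamma> / 2 * ((?n - 2 + \<gamma>) / (?n + 2)) * e\<^sup>2 + 6 * \<gamma> * e ^ 3))" .
  have "a / V \<le> b * c" if "a \<le> b * (V * c)" for a b c :: real
    using that V by (simp add: pos_divide_le_eq mult_ac)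
  from this[OF bound] show ?thesis unfolding V_def e_def r_def .
qed

section \<open>The barrier\<close>

text \<open>
  The second-order coefficients of the game step: the coin toss contributes
  \<open>- \<gamma> (1 - \<gamma>) / 2\<close> and the random move \<open>(\<gamma> / 2) (n - 2 + \<gamma>) / (n + 2)\<close>; weighted with \<open>\<alpha>\<close> and \<open>\<beta>\<close> they add up to a
  positive multiple of \<open>(p - 1) \<gamma> - (p - n)\<close>, the sign of the \<open>p\<close>-Laplacian of \<open>|x|^\<gamma>\<close>.
\<close>

lemma tug_noise_drift:
  fixes N p \<gamma> e :: real
  assumes "N + p > 0" "N + 2 > 0"
  shows "(p - 2) / (N + p) / 2 * (2 - \<gamma> * (1 - \<gamma>) * e\<^sup>2)
      + (N + 2) / (N + p) * (1 + \<gamma> / 2 * ((N - 2 + \<gamma>) / (N + 2)) * e\<^sup>2 + 6 * \<gamma> * e ^ 3)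
    = 1 + \<gamma> * e\<^sup>2 / (2 * (N + p)) * (((p - 1) * \<gamma> - (p - N)) + 12 * (N + 2) * e)"
proof -
  \<comment> \<open>Halving \<open>\<gamma>\<close> clears the denominators, which leaves a polynomial identity.\<close>
  define k l where "k = \<gamma> / 2" and "l = 1 / (2 * (N + p))"
  have \<gamma>: "\<gamma> = 2 * k" by (simp add: k_def)
  have l: "(p - 2) / (N + p) / 2 = (p - 2) * l"
    "\<gamma> * e\<^sup>2 / (2 * (N + p)) = 2 * k * e\<^sup>2 * l" "2 * (N + p) * l = 1"
    using assms by (simp_all add: l_def \<gamma>)
  have l': "(N + 2) / (N + p) = 2 * l * (N + 2)"
    using assms(1) unfolding l_def by (simp add: divide_simps) (simp add: algebra_simps)
  have "(N + 2) * (1 + k * ((N - 2 + 2 * k) / (N + 2)) * e\<^sup>2 + 6 * (2 * k) * e ^ 3)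
      = (N + 2) + k * (N - 2 + 2 * k) * e\<^sup>2 + 12 * (N + 2) * k * e ^ 3"
    using assms by (simp add: distrib_left)
  then have noise: "2 * l * (N + 2) * (1 + k * ((N - 2 + 2 * k) / (N + 2)) * e\<^sup>2 + 6 * (2 * k) * e ^ 3)
      = 2 * l * ((N + 2) + k * (N - 2 + 2 * k) * e\<^sup>2 + 12 * (N + 2) * k * e ^ 3)"
    by (simp only: mult.assoc)
  have "(p - 2) * l * (2 - 2 * k * (1 - 2 * k) * e\<^sup>2)
      + 2 * l * ((N + 2) + k * (N - 2 + 2 * k) * e\<^sup>2 + 12 * (N + 2) * k * e ^ 3)
    = 2 * (N + p) * l + 2 * k * e\<^sup>2 * l * (((p - 1) * (2 * k) - (p - N)) + 12 * (N + 2) * e)"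
    by (simp add: algebra_simps power2_eq_square power3_eq_cube)
  then have "(p - 2) * l * (2 - 2 * k * (1 - 2 * k) * e\<^sup>2)
      + 2 * l * ((N + 2) + k * (N - 2 + 2 * k) * e\<^sup>2 + 12 * (N + 2) * k * e ^ 3)
    = 1 + 2 * k * e\<^sup>2 * l * (((p - 1) * (2 * k) - (p - N)) + 12 * (N + 2) * e)"
    unfolding l(3) .
  then show ?thesis
    unfolding l(1,2) l' k_def[symmetric] unfolding \<gamma> noise .
qed

text \<open>
  The fundamental solution of the \<open>p\<close>-Laplacian is \<open>|x|\<close> to the power \<open>(p - n) / (p - 1)\<close>. Half
  of this exponent is positive because \<open>p > n\<close>, and it makes the power a strict supersolution.
\<close>

definition barrier_exponent :: "real \<Rightarrow> nat \<Rightarrow> real" where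
  "barrier_exponent p n = (p - real n) / (2 * (p - 1))"

lemma barrier_exponent_bounds:
  assumes "p > 2" "p > real n" "n > 0"
  shows "0 < barrier_exponent p n" "barrier_exponent p n < 1"
  using assms by (auto simp: barrier_exponent_def field_simps)

text \<open>
  The second-order gain is \<open>(p - n) / 2\<close> and the cubic error is at most \<open>12 (n + 2) e\<close> in the same
  units, with \<open>e = \<epsilon> / |x|\<close>. The hypothesis bounds the error by half of the gain. It is
  invariant under scaling, so the constants depend on \<open>n\<close> and \<open>p\<close> only. The left-hand side is
  the game step applied to \<open>|x|^\<gamma>\<close>, with the extrema over the ball inserted.
\<close>

lemma norm_powr_strict_supersolution:
  fixes x :: "real^'n" and p \<epsilon> :: real
  defines "n \<equiv> CARD('n)" and "\<gamma> \<equiv> barrier_exponent p CARD('n)"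
  assumes p: "p > 2" "p > real CARD('n)"
    and \<epsilon>: "\<epsilon> > 0" "48 * (real CARD('n) + p) * \<epsilon> \<le> (p - real CARD('n)) * norm x"
  shows "tug_alpha p n / 2 * ((norm x + \<epsilon>) powr \<gamma> + (norm x - \<epsilon>) powr \<gamma>)
      + tug_beta p n / measure lborel (ball (0::real^'n) \<epsilon>) *
          (LINT h:ball 0 \<epsilon>|lborel. norm (x + h) powr \<gamma>)
    \<le> norm x powr \<gamma> * (1 - \<gamma> * (p - real n) / (8 * (real n + p)) * (\<epsilon> / norm x)\<^sup>2)"
proof -
  define r e A where "r = norm x" and "e = \<epsilon> / norm x"
    and "A = (LINT h:ball 0 \<epsilon>|lborel. norm (x + h) powr \<gamma>) / measure lborel (ball (0::real^'n) \<epsilon>)"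
  have n: "real n \<ge> 1" unfolding n_def by (simp add: Suc_leI)
  have pn: "p > real n" using p n_def by simp
  have \<gamma>: "0 < \<gamma>" "\<gamma> < 1" unfolding \<gamma>_def using p by (auto intro!: barrier_exponent_bounds)
  have "0 < (p - real n) * r" using \<epsilon> p unfolding r_def n_def
    by (smt (verit, best) mult_pos_pos of_nat_0_le_iff)
  then have r: "r > 0" using pn by (simp add: zero_less_mult_iff)
  have \<epsilon>r: "\<epsilon> = e * r" using r by (simp add: e_def r_def)
  have e: "e > 0" "48 * (real n + p) * e \<le> p - real n"
    using \<epsilon> r unfolding \<epsilon>r n_def[symmetric] r_def[symmetric]
    by (auto simp: zero_less_mult_iff)
  \<comment> \<open>Since \<open>p - n < 48 (n + p)\<close>, the hypothesis also keeps the ball away from the origin.\<close>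
  have "e < 1"
  proof (rule ccontr)
    assume "\<not> e < 1"
    then have "48 * (real n + p) \<le> 48 * (real n + p) * e"
      using p n by (simp add: mult_le_cancel_left1)
    moreover have "p - real n < 48 * (real n + p)" using pn n by simp
    ultimately show False using e(2) by simp
  qed
  have le: "A \<le> r powr \<gamma> * (1 + \<gamma> / 2 * ((real n - 2 + \<gamma>) / (real n + 2)) * e\<^sup>2 + 6 * \<gamma> * e ^ 3)"
    using mean_norm_powr_le[OF \<gamma> \<epsilon>(1), of x] r \<open>e < 1\<close>
    unfolding A_def e_def r_def n_def by simp
  have "(r + \<epsilon>) powr \<gamma> + (r - \<epsilon>) powr \<gamma> = r powr \<gamma> * ((1 + e) powr \<gamma> + (1 - e) powr \<gamma>)"
  proof -
    have "r + \<epsilon> = r * (1 + e)" "r - \<epsilon> = r * (1 - e)" unfolding \<epsilon>r by (auto simp: algebra_simps)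
    then have "(r + \<epsilon>) powr \<gamma> = r powr \<gamma> * (1 + e) powr \<gamma>" "(r - \<epsilon>) powr \<gamma> = r powr \<gamma> * (1 - e) powr \<gamma>"
      using r e(1) \<open>e < 1\<close> by (simp_all only:) (simp_all add: powr_mult)
    then show ?thesis by (simp add: distrib_left)
  qed
  also have "\<dots> \<le> r powr \<gamma> * (2 - \<gamma> * (1 - \<gamma>) * e\<^sup>2)"
    by (rule mult_left_mono[OF powr_symmetric_le]) (use \<gamma> e(1) \<open>e < 1\<close> in auto)
  finally have tug: "(r + \<epsilon>) powr \<gamma> + (r - \<epsilon>) powr \<gamma> \<le> r powr \<gamma> * (2 - \<gamma> * (1 - \<gamma>) * e\<^sup>2)" .
  have "tug_alpha p n / 2 * ((r + \<epsilon>) powr \<gamma> + (r - \<epsilon>) powr \<gamma>) + tug_beta p n * A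
      \<le> tug_alpha p n / 2 * (r powr \<gamma> * (2 - \<gamma> * (1 - \<gamma>) * e\<^sup>2)) + tug_beta p n *
         (r powr \<gamma> * (1 + \<gamma> / 2 * ((real n - 2 + \<gamma>) / (real n + 2)) * e\<^sup>2 + 6 * \<gamma> * e ^ 3))"
    using p n tug le by (intro add_mono mult_left_mono) (auto simp: tug_alpha_def tug_beta_def)
  also have "\<dots> = r powr \<gamma> * (1 + \<gamma> * e\<^sup>2 / (2 * (real n + p)) *
      (((p - 1) * \<gamma> - (p - real n)) + 12 * (real n + 2) * e))"
  proof -
    have "real n + p > 0" "real n + 2 > 0" using n p by auto
    note drift = tug_noise_drift[OF this, of \<gamma> e, folded tug_alpha_def tug_beta_def]
    show ?thesis unfolding drift[symmetric] by (simp only: distrib_left mult.left_commute)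
  qed
  also have "\<dots> \<le> r powr \<gamma> * (1 + \<gamma> * e\<^sup>2 / (2 * (real n + p)) * (- (p - real n) / 4))"
  proof -
    define d s where "d = p - real n" and "s = 12 * (real n + 2) * e"
    have \<gamma>_eq: "(p - 1) * \<gamma> = d / 2"
      using p unfolding \<gamma>_def barrier_exponent_def n_def d_def by (simp add: field_simps)
    have "s \<le> 12 * (real n + p) * e"
      unfolding s_def using e p by (intro mult_right_mono) auto
    also have "\<dots> = (48 * (real n + p) * e) / 4" by simp
    also have "\<dots> \<le> d / 4" using e(2) unfolding d_def by (rule divide_right_mono) simp
    finally have "(p - 1) * \<gamma> - d + s \<le> - d / 4" unfolding \<gamma>_eq by simp
    then have "((p - 1) * \<gamma> - (p - real n)) + 12 * (real n + 2) * e \<le> - (p - real n) / 4"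
      unfolding d_def s_def .
    then show ?thesis using \<gamma> e n p r by (intro mult_left_mono add_left_mono) auto
  qed
  also have "\<dots> = r powr \<gamma> * (1 - \<gamma> * (p - real n) / (8 * (real n + p)) * e\<^sup>2)"
  proof -
    have "\<gamma> * e\<^sup>2 / (2 * P) * (- d / 4) = - (\<gamma> * d / (8 * P) * e\<^sup>2)" for P d :: real by simp
    then show ?thesis by (simp only: diff_conv_add_uminus)
  qed
  finally show ?thesis unfolding A_def r_def e_def by simp
qed

section \<open>Consequences of the dynamic programming principle\<close>

text \<open>
  A segment that leaves the domain meets its frontier.
\<close>

lemma ball_subset_extended_domain:
  fixes x :: "real^'n"
  assumes "x \<in> \<Omega>"
  shows "ball x \<epsilon> \<subseteq> extended_domain \<Omega> \<epsilon>"
proof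
  fix y assume y: "y \<in> ball x \<epsilon>"
  show "y \<in> extended_domain \<Omega> \<epsilon>"
  proof (cases "y \<in> \<Omega>")
    case False
    have "closed_segment x y \<inter> frontier \<Omega> \<noteq> {}"
      using assms False by (intro connected_Int_frontier) auto
    then obtain z where z: "z \<in> closed_segment x y" "z \<in> frontier \<Omega>" by auto
    have "infdist y (frontier \<Omega>) \<le> dist y z" using z(2) by (rule infdist_le)
    also have "\<dots> \<le> dist y x"
      using dist_in_closed_segment[OF z(1)] by (simp add: dist_commute)
    also have "\<dots> \<le> \<epsilon>" using y by (simp add: dist_commute)
    finally show ?thesis using False by (simp add: extended_domain_def boundary_strip_def)
  qed (simp add: extended_domain_def)
qed

lemma extended_domain_borel:
  fixes \<Omega> :: "(real^'n) set"
  assumes "open \<Omega>"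
  shows "extended_domain \<Omega> \<epsilon> \<in> sets borel"
proof -
  have "boundary_strip \<Omega> \<epsilon> = - \<Omega> \<inter> {x. infdist x (frontier \<Omega>) \<le> \<epsilon>}"
    by (auto simp: boundary_strip_def)
  moreover have "closed {x. infdist x (frontier \<Omega>) \<le> \<epsilon>}"
    by (intro closed_Collect_le continuous_intros)
  ultimately show ?thesis
    using assms unfolding extended_domain_def by auto
qed

lemma p_harmonious_integrable_ball:
  fixes u :: "real^'n \<Rightarrow> real"
  assumes "open \<Omega>" "p_harmonious p \<Omega> \<epsilon> u" "x \<in> \<Omega>"
  shows "set_integrable lborel (ball x \<epsilon>) u"
proof -
  let ?E = "extended_domain \<Omega> \<epsilon>"
  have "u \<in> borel_measurable (restrict_space borel ?E)"
    and bdd: "bounded (u ` ball x \<epsilon>)"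
    using assms by (auto simp: p_harmonious_def dynamic_programming_def)
  then have E: "(\<lambda>z. indicator ?E z *\<^sub>R u z) \<in> borel_measurable borel"
    using extended_domain_borel[OF assms(1)] by (subst (asm) borel_measurable_restrict_space_iff) auto
  have "(\<lambda>z. indicator (ball x \<epsilon>) z *\<^sub>R (indicator ?E z *\<^sub>R u z)) \<in> borel_measurable borel"
    by (intro borel_measurable_scaleR borel_measurable_indicator E) auto
  also have "(\<lambda>z. indicator (ball x \<epsilon>) z *\<^sub>R (indicator ?E z *\<^sub>R u z)) = (\<lambda>z. indicator (ball x \<epsilon>) z *\<^sub>R u z)"
    using ball_subset_extended_domain[OF assms(3), of \<epsilon>] by (auto simp: indicator_def fun_eq_iff)
  finally have meas: "(\<lambda>z. indicator (ball x \<epsilon>) z *\<^sub>R u z) \<in> borel_measurable borel" .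
  obtain b where b: "\<And>z. z \<in> ball x \<epsilon> \<Longrightarrow> norm (u z) \<le> b"
    using bdd unfolding bounded_iff by blast
  show ?thesis unfolding set_integrable_def
  proof (rule integrableI_bounded_set[where A = "ball x \<epsilon>" and B = b])
    show "emeasure lborel (ball x \<epsilon>) < \<infinity>" by (rule emeasure_lborel_ball_finite)
  qed (use meas b in \<open>auto simp: indicator_def\<close>)
qed

text \<open>
  The operator on the right-hand side of the dynamic programming principle is monotone. The
  point \<open>b\<close> may lie on the boundary of the ball because \<open>w\<close> is continuous, so that a radial \<open>w\<close>
  can be evaluated at its extremal points.
\<close>

lemma dynamic_programming_ge_test_function:
  fixes u w :: "real^'n \<Rightarrow> real"
  assumes "open \<Omega>" "p_harmonious p \<Omega> \<epsilon> u" "x \<in> \<Omega>" "p > 2" "\<epsilon> > 0"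
    and w: "continuous_on UNIV w" "\<And>z. z \<in> ball x \<epsilon> \<Longrightarrow> w z \<le> u z"
    and a: "\<And>z. z \<in> ball x \<epsilon> \<Longrightarrow> w a \<le> w z" and b: "b \<in> cball x \<epsilon>"
  shows "tug_alpha p CARD('n) / 2 * (w a + w b)
      + tug_beta p CARD('n) / measure lborel (ball x \<epsilon>) * (LINT z:ball x \<epsilon>|lborel. w z) \<le> u x"
proof -
  have dpp: "u x = tug_alpha p CARD('n) / 2 * ((INF y\<in>ball x \<epsilon>. u y) + (SUP y\<in>ball x \<epsilon>. u y))
         + tug_beta p CARD('n) / measure lborel (ball x \<epsilon>) * (LINT z:ball x \<epsilon>|lborel. u z)"
    and bdd: "bounded (u ` ball x \<epsilon>)"
    using assms(2,3) by (auto simp: p_harmonious_def dynamic_programming_def)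
  have inf: "w a \<le> (INF y\<in>ball x \<epsilon>. u y)"
    using \<open>\<epsilon> > 0\<close> a w(2) by (intro cINF_greatest) (auto intro: order_trans)
  have "ball x \<epsilon> \<subseteq> {z. w z \<le> (SUP y\<in>ball x \<epsilon>. u y)}"
    using w(2) bounded_imp_bdd_above[OF bdd] by (auto intro: cSUP_upper2)
  moreover have "closed {z. w z \<le> (SUP y\<in>ball x \<epsilon>. u y)}"
    using w(1) by (intro closed_Collect_le continuous_intros)
  ultimately have "closure (ball x \<epsilon>) \<subseteq> {z. w z \<le> (SUP y\<in>ball x \<epsilon>. u y)}"
    by (rule closure_minimal)
  then have sup: "w b \<le> (SUP y\<in>ball x \<epsilon>. u y)"
    using b \<open>\<epsilon> > 0\<close> by auto
  have "(LINT z:ball x \<epsilon>|lborel. w z) \<le> (LINT z:ball x \<epsilon>|lborel. u z)"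
    using w assms by (intro set_integral_mono continuous_set_integrable_ball p_harmonious_integrable_ball)
  then show ?thesis
    unfolding dpp using inf sup \<open>p > 2\<close>
    by (intro add_mono mult_left_mono) (auto simp: tug_alpha_def tug_beta_def)
qed

text \<open>
  The coin toss lets Player I move to \<open>y\<close> with probability \<open>\<alpha> / 2\<close>; the other outcomes contribute
  nonnegative payoffs.
\<close>

lemma p_harmonious_one_step:
  fixes u :: "real^'n \<Rightarrow> real"
  assumes "p_harmonious p \<Omega> \<epsilon> u" "p > 2" "\<And>z. z \<in> extended_domain \<Omega> \<epsilon> \<Longrightarrow> u z > 0"
    and "x \<in> \<Omega>" "y \<in> ball x \<epsilon>"
  shows "tug_alpha p CARD('n) / 2 * u y \<le> u x"
proof -
  have dpp: "u x = tug_alpha p CARD('n) / 2 * ((INF y\<in>ball x \<epsilon>. u y) + (SUP y\<in>ball x \<epsilon>. u y))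
         + tug_beta p CARD('n) / measure lborel (ball x \<epsilon>) * (LINT z:ball x \<epsilon>|lborel. u z)"
    and bdd: "bounded (u ` ball x \<epsilon>)"
    using assms by (auto simp: p_harmonious_def dynamic_programming_def)
  have pos: "u z \<ge> 0" if "z \<in> ball x \<epsilon>" for z
    using assms(3) ball_subset_extended_domain[OF assms(4), of \<epsilon>] that by (meson less_imp_le subsetD)
  have "ball x \<epsilon> \<noteq> {}" using assms(5) by blast
  then have "(INF y\<in>ball x \<epsilon>. u y) \<ge> 0" using pos by (intro cINF_greatest)
  moreover have "(SUP y\<in>ball x \<epsilon>. u y) \<ge> u y"
    using assms(5) bounded_imp_bdd_above[OF bdd] by (intro cSUP_upper)
  moreover have "(LINT z:ball x \<epsilon>|lborel. u z) \<ge> 0"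
    unfolding set_lebesgue_integral_def using pos
    by (intro Bochner_Integration.integral_nonneg) (auto simp: indicator_def)
  moreover have "tug_alpha p CARD('n) \<ge> 0" "tug_beta p CARD('n) \<ge> 0"
    using \<open>p > 2\<close> by (auto simp: tug_alpha_def tug_beta_def)
  ultimately have "tug_alpha p CARD('n) / 2 * (0 + u y) + 0 \<le> u x"
    unfolding dpp by (intro add_mono mult_left_mono mult_nonneg_nonneg divide_nonneg_nonneg) auto
  then show ?thesis by simp
qed

text \<open>
  One step at a time along the segment from \<open>x\<close> to \<open>y\<close>. The step length \<open>s\<close> is smaller than
  \<open>\<epsilon>\<close> because the moves are confined to open balls.
\<close>

lemma p_harmonious_chain:
  fixes u :: "real^'n \<Rightarrow> real"
  assumes "p_harmonious p \<Omega> \<epsilon> u" "p > 2" "\<And>z. z \<in> extended_domain \<Omega> \<epsilon> \<Longrightarrow> u z > 0"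
    and "convex S" "S \<subseteq> \<Omega>" "y \<in> S" "s < \<epsilon>"
    and "x \<in> S" "dist x y \<le> real k * s"
  shows "(tug_alpha p CARD('n) / 2) ^ k * u y \<le> u x"
  using assms(8,9)
proof (induction k arbitrary: x)
  case (Suc k)
  define z where "z = x + (1 / real (Suc k)) *\<^sub>R (y - x)"
  have z: "z = (1 - 1 / real (Suc k)) *\<^sub>R x + (1 / real (Suc k)) *\<^sub>R y"
    unfolding z_def by (simp add: algebra_simps)
  have "z \<in> S"
    unfolding z using assms(4,6) Suc.prems(1) by (intro convexD) auto
  have "dist x z = dist x y / real (Suc k)"
    unfolding z_def by (simp add: dist_norm norm_minus_commute)
  also have "\<dots> \<le> s" using Suc.prems(2) by (simp add: divide_le_eq mult.commute)
  finally have "z \<in> ball x \<epsilon>" using assms(7) by simp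
  have "z - y = (real k / real (Suc k)) *\<^sub>R (x - y)"
    unfolding z by (simp add: field_simps scaleR_diff_right flip: scaleR_add_left scaleR_diff_left)
  then have "dist z y = real k / real (Suc k) * dist x y"
    by (simp add: dist_norm)
  also have "\<dots> \<le> real k / real (Suc k) * (real (Suc k) * s)"
    using Suc.prems(2) by (intro mult_left_mono) auto
  finally have "dist z y \<le> real k * s" by simp
  have nonneg: "tug_alpha p CARD('n) / 2 \<ge> 0" using \<open>p > 2\<close> by (simp add: tug_alpha_def)
  have "(tug_alpha p CARD('n) / 2) ^ Suc k * u y
      = tug_alpha p CARD('n) / 2 * ((tug_alpha p CARD('n) / 2) ^ k * u y)" by simp
  also have "\<dots> \<le> tug_alpha p CARD('n) / 2 * u z"
    using Suc.IH[OF \<open>z \<in> S\<close> \<open>dist z y \<le> real k * s\<close>] nonneg by (rule mult_left_mono)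
  also have "\<dots> \<le> u x"
    using assms(5) Suc.prems(1) \<open>z \<in> ball x \<epsilon>\<close>
    by (intro p_harmonious_one_step[OF assms(1-3)]) auto
  finally show ?case .
qed simp

section \<open>Comparison and the Harnack inequality\<close>

text \<open>
  Comparison with the strict subsolution \<open>v = \<kappa> (1 - (|z - y| / R)^\<gamma>)\<close>. If \<open>v - u\<close> had a positive
  supremum \<open>M\<close> over the ball, then \<open>v - M \<le> u\<close> would hold on the whole extended domain, since
  \<open>v \<le> 0\<close> outside the ball. One game step improves this to \<open>v - M + \<delta> \<le> u\<close> away from the pole,
  with \<open>\<delta> > 0\<close> independent of the point, and close to the pole \<open>v \<le> \<kappa> \<le> u\<close> by assumption. This
  contradicts the choice of \<open>M\<close>. The uniform \<open>\<delta>\<close> lets the argument work with the supremum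
  itself, which may not be attained because \<open>u\<close> may be discontinuous.
\<close>

lemma p_harmonious_ge_power_barrier:
  fixes u :: "real^'n \<Rightarrow> real" and p :: real
  defines "n \<equiv> real CARD('n)" and "\<gamma> \<equiv> barrier_exponent p CARD('n)"
  assumes "open \<Omega>" "p_harmonious p \<Omega> \<epsilon> u" "p > 2" "p > n" "\<epsilon> > 0"
    and pos: "\<And>z. z \<in> extended_domain \<Omega> \<epsilon> \<Longrightarrow> u z > 0"
    and sub: "ball y R \<subseteq> \<Omega>" and "R > 0" "\<kappa> > 0"
    and near: "\<And>x. x \<in> ball y R \<Longrightarrow> (p - n) * dist x y < 48 * (n + p) * \<epsilon> \<Longrightarrow> \<kappa> \<le> u x"
    and "x \<in> ball y R"
  shows "\<kappa> * (1 - (dist x y / R) powr \<gamma>) \<le> u x"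
proof -
  define \<mu> where "\<mu> = \<kappa> / R powr \<gamma>"
  define v where "v = (\<lambda>z. \<kappa> - \<mu> * dist z y powr \<gamma>)"
  define M where "M = (SUP z\<in>ball y R. v z - u z)"
  define c where "c = \<gamma> * (p - n) / (8 * (n + p))"
  define \<delta> where "\<delta> = \<mu> * (\<epsilon> powr \<gamma> * (c * (\<epsilon> / R)\<^sup>2))"
  have n: "n \<ge> 0" by (simp add: n_def)
  have \<gamma>: "0 < \<gamma>" "\<gamma> < 1"
    unfolding \<gamma>_def using \<open>p > 2\<close> \<open>p > n\<close> by (auto intro!: barrier_exponent_bounds simp: n_def)
  have \<mu>: "\<mu> > 0" using \<open>R > 0\<close> \<open>\<kappa> > 0\<close> by (simp add: \<mu>_def)
  have c: "c > 0" using \<gamma> \<open>p > 2\<close> \<open>p > n\<close> n by (simp add: c_def)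
  have \<delta>: "\<delta> > 0" using \<mu> c \<open>\<epsilon> > 0\<close> \<open>R > 0\<close> by (simp add: \<delta>_def)
  have v: "v z = \<kappa> * (1 - (dist z y / R) powr \<gamma>)" for z
    using \<open>R > 0\<close> by (simp add: v_def \<mu>_def powr_divide algebra_simps)
  have u_pos: "u z > 0" if "z \<in> ball y R" for z
    using that sub by (intro pos) (auto simp: extended_domain_def)
  have v_le: "v z \<le> \<kappa>" for z using \<mu> by (simp add: v_def)
  have bdd: "bdd_above ((\<lambda>z. v z - u z) ` ball y R)"
    by (rule bdd_aboveI2[where M = \<kappa>]) (use v_le u_pos in \<open>smt (verit)\<close>)
  have "v x \<le> u x"
  proof (rule ccontr)
    assume "\<not> v x \<le> u x"
    then have M: "M > 0"
      unfolding M_def using cSUP_upper[OF \<open>x \<in> ball y R\<close> bdd] by linarith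
    have above: "v z - M \<le> u z" if "z \<in> extended_domain \<Omega> \<epsilon>" for z
    proof (cases "z \<in> ball y R")
      case True
      then have "v z - u z \<le> M" unfolding M_def using bdd by (intro cSUP_upper)
      then show ?thesis by simp
    next
      case False
      then have "1 powr \<gamma> \<le> (dist z y / R) powr \<gamma>"
        using \<open>R > 0\<close> \<gamma> by (intro powr_mono2) (auto simp: dist_commute)
      then have "v z \<le> 0" unfolding v using \<open>\<kappa> > 0\<close> by (simp add: mult_le_0_iff)
      then show ?thesis using M pos[OF that] by simp
    qed
    have "v \<xi> - u \<xi> \<le> max 0 (M - \<delta>)" if \<xi>: "\<xi> \<in> ball y R" for \<xi>
    proof (cases "(p - n) * dist \<xi> y < 48 * (n + p) * \<epsilon>")
      case True
      then show ?thesis using near[OF \<xi>] v_le[of \<xi>] by simp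
    next
      case False
      define r where "r = dist \<xi> y"
      let ?V = "measure lborel (ball \<xi> \<epsilon>)"
      have far: "48 * (n + p) * \<epsilon> \<le> (p - n) * r" using False by (simp add: r_def)
      have "(p - n) * \<epsilon> \<le> 48 * (n + p) * \<epsilon>"
        using n \<open>p > n\<close> \<open>\<epsilon> > 0\<close> by (intro mult_right_mono) auto
      then have "(p - n) * \<epsilon> \<le> (p - n) * r" using far by simp
      then have r: "\<epsilon> \<le> r" "r > 0" "r < R"
        using \<open>p > n\<close> \<open>\<epsilon> > 0\<close> \<xi> by (auto simp: r_def dist_commute)
      define w where "w = (\<lambda>z. v z - M)"
      \<comment> \<open>On the closed ball around \<open>\<xi>\<close>, \<open>v\<close> is smallest at \<open>\<xi> + d\<close> and largest at \<open>\<xi> - d\<close>, the points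
        farthest from and nearest to \<open>y\<close>.\<close>
      define d where "d = (\<epsilon> / r) *\<^sub>R (\<xi> - y)"
      have norm_d: "norm d = \<epsilon>" using r \<open>\<epsilon> > 0\<close> by (simp add: d_def r_def dist_norm)
      have a: "dist (\<xi> + d) y = r + \<epsilon>"
      proof -
        have "\<xi> + d - y = (1 + \<epsilon> / r) *\<^sub>R (\<xi> - y)" by (simp add: d_def algebra_simps)
        then have "dist (\<xi> + d) y = (1 + \<epsilon> / r) * r" using r \<open>\<epsilon> > 0\<close> by (simp add: dist_norm r_def)
        then show ?thesis using r(2) by (simp add: distrib_right)
      qed
      have b: "dist (\<xi> - d) y = r - \<epsilon>"
      proof -
        have "\<xi> - d - y = (1 - \<epsilon> / r) *\<^sub>R (\<xi> - y)" by (simp add: d_def algebra_simps)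
        then have "dist (\<xi> - d) y = (1 - \<epsilon> / r) * r" using r \<open>\<epsilon> > 0\<close> by (simp add: dist_norm r_def)
        then show ?thesis using r(2) by (simp add: left_diff_distrib)
      qed
      have "\<xi> \<in> \<Omega>" using \<xi> sub by auto
      have cont: "continuous_on UNIV (\<lambda>z. dist z y powr \<gamma>)"
        using \<gamma> by (intro continuous_on_powr' continuous_intros) auto
      have DPP: "tug_alpha p CARD('n) / 2 * (w (\<xi> + d) + w (\<xi> - d))
          + tug_beta p CARD('n) / ?V * (LINT z:ball \<xi> \<epsilon>|lborel. w z) \<le> u \<xi>"
      proof (rule dynamic_programming_ge_test_function[OF assms(3,4) \<open>\<xi> \<in> \<Omega>\<close> \<open>p > 2\<close> \<open>\<epsilon> > 0\<close>])
        show "continuous_on UNIV w" unfolding w_def v_def by (intro continuous_intros cont)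
        show "w z \<le> u z" if "z \<in> ball \<xi> \<epsilon>" for z
          unfolding w_def using above ball_subset_extended_domain[OF \<open>\<xi> \<in> \<Omega>\<close>] that by blast
        show "\<xi> - d \<in> cball \<xi> \<epsilon>" using norm_d by (simp add: dist_norm)
        fix z assume "z \<in> ball \<xi> \<epsilon>"
        then have "dist z y \<le> r + \<epsilon>"
          using dist_triangle[of z y \<xi>] by (simp add: r_def dist_commute)
        then have "dist z y powr \<gamma> \<le> dist (\<xi> + d) y powr \<gamma>" unfolding a using \<gamma> by (intro powr_mono2) auto
        then show "w (\<xi> + d) \<le> w z" unfolding w_def v_def using \<mu> by simp
      qed
      define I where "I = (LINT z:ball \<xi> \<epsilon>|lborel. dist z y powr \<gamma>)"
      have V: "?V > 0" using \<open>\<epsilon> > 0\<close> by simp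
      have int_w: "(LINT z:ball \<xi> \<epsilon>|lborel. w z) = (\<kappa> - M) * ?V - \<mu> * I"
      proof -
        have "(LINT z:ball \<xi> \<epsilon>|lborel. w z) = (LINT z:ball \<xi> \<epsilon>|lborel. (\<kappa> - M) - \<mu> * dist z y powr \<gamma>)"
          by (simp add: w_def v_def algebra_simps)
        also have "\<dots> = (LINT z:ball \<xi> \<epsilon>|lborel. \<kappa> - M) - (LINT z:ball \<xi> \<epsilon>|lborel. \<mu> * dist z y powr \<gamma>)"
          by (intro set_integral_diff continuous_set_integrable_ball continuous_intros cont)
        also have "(LINT z:ball \<xi> \<epsilon>|lborel. \<kappa> - M) = (\<kappa> - M) * ?V"
          using emeasure_lborel_ball_finite[of \<xi> \<epsilon>] by (simp add: set_lebesgue_integral_def)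
        finally show ?thesis by (simp add: I_def)
      qed
      have \<alpha>\<beta>: "tug_alpha p CARD('n) + tug_beta p CARD('n) = 1"
        using \<open>p > 2\<close> by (simp add: tug_alpha_def tug_beta_def add_divide_distrib[symmetric])
      have I_shift: "I = (LINT h:ball 0 \<epsilon>|lborel. norm ((\<xi> - y) + h) powr \<gamma>)"
        unfolding I_def using set_integral_ball_affine[of 1 "\<lambda>z. dist z y powr \<gamma>" \<xi> \<epsilon>] cont
        by (simp add: borel_measurable_continuous_onI dist_norm algebra_simps)
      have V0: "measure lborel (ball (0::real^'n) \<epsilon>) = ?V"
        using \<open>\<epsilon> > 0\<close> by (simp add: content_ball)
      have super: "tug_alpha p CARD('n) / 2 * ((r + \<epsilon>) powr \<gamma> + (r - \<epsilon>) powr \<gamma>)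
          + tug_beta p CARD('n) / ?V * I \<le> r powr \<gamma> * (1 - c * (\<epsilon> / r)\<^sup>2)"
        using norm_powr_strict_supersolution[of p \<epsilon> "\<xi> - y"] \<open>p > 2\<close> \<open>p > n\<close> \<open>\<epsilon> > 0\<close> far
        unfolding I_shift V0 \<gamma>_def c_def r_def n_def by (simp add: dist_norm)
      \<comment> \<open>The gain \<open>r^\<gamma> c (\<epsilon> / r)^2\<close> is bounded below uniformly in \<open>\<epsilon> \<le> r < R\<close>; this is \<open>\<delta>\<close>.\<close>
      have "\<epsilon> powr \<gamma> * (c * (\<epsilon> / R)\<^sup>2) \<le> r powr \<gamma> * (c * (\<epsilon> / r)\<^sup>2)"
        using r c \<gamma> \<open>\<epsilon> > 0\<close>
        by (intro mult_mono mult_left_mono power_mono divide_left_mono powr_mono2) auto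
      then have "\<delta> \<le> \<mu> * (r powr \<gamma> * (c * (\<epsilon> / r)\<^sup>2))"
        unfolding \<delta>_def using \<mu> by simp
      then have "v \<xi> - M + \<delta> \<le> \<kappa> - M - \<mu> * (r powr \<gamma> * (1 - c * (\<epsilon> / r)\<^sup>2))"
        by (simp add: v_def r_def algebra_simps)
      also have "\<dots> \<le> \<kappa> - M - \<mu> * (tug_alpha p CARD('n) / 2 * ((r + \<epsilon>) powr \<gamma> + (r - \<epsilon>) powr \<gamma>)
          + tug_beta p CARD('n) / ?V * I)"
        using super \<mu> by (intro diff_left_mono mult_left_mono) auto
      also have "\<dots> = (\<kappa> - M) * (tug_alpha p CARD('n) + tug_beta p CARD('n)) -
          \<mu> * (tug_alpha p CARD('n) / 2 * ((r + \<epsilon>) powr \<gamma> + (r - \<epsilon>) powr \<gamma>)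
          + tug_beta p CARD('n) / ?V * I)"
        unfolding \<alpha>\<beta> by simp
      also have "\<dots> = tug_alpha p CARD('n) / 2 * (w (\<xi> + d) + w (\<xi> - d))
          + tug_beta p CARD('n) / ?V * (LINT z:ball \<xi> \<epsilon>|lborel. w z)"
        unfolding int_w unfolding w_def v_def a b using V by (simp add: field_simps)
      also have "\<dots> \<le> u \<xi>" by (rule DPP)
      finally show ?thesis by simp
    qed
    then have "M \<le> max 0 (M - \<delta>)"
      unfolding M_def using \<open>R > 0\<close> by (intro cSUP_least) auto
    then show False using M \<delta> by simp
  qed
  then show ?thesis unfolding v .
qed

theorem corollary6p2:
  fixes p :: real
  assumes "p > 2" and "p > real CARD('n::finite)"
  shows "\<exists>C>0. \<forall>(\<Omega> :: (real ^ 'n) set) (\<epsilon> :: real) (u :: real ^ 'n \<Rightarrow> real)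
            (z\<^sub>0 :: real ^ 'n) (\<rho> :: real).
          bounded_domain \<Omega> \<longrightarrow> \<epsilon> > 0 \<longrightarrow> p_harmonious p \<Omega> \<epsilon> u \<longrightarrow>
          (\<forall>x\<in>extended_domain \<Omega> \<epsilon>. u x > 0) \<longrightarrow>
          \<rho> > 0 \<longrightarrow> ball z\<^sub>0 (5 * \<rho>) \<subseteq> \<Omega> \<longrightarrow>
          (SUP x\<in>ball z\<^sub>0 \<rho>. u x) \<le> C * (INF x\<in>ball z\<^sub>0 \<rho>. u x)"
proof -
  let ?n = "real CARD('n)"
  define \<gamma> where "\<gamma> = barrier_exponent p CARD('n)"
  \<comment> \<open>Within distance \<open>m \<epsilon>\<close> of the pole the barrier inequality may fail; \<open>2 m\<close> steps of length
    \<open>\<epsilon> / 2\<close> bridge this distance.\<close>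
  define m where "m = nat \<lceil>48 * (?n + p) / (p - ?n)\<rceil>"
  define c where "c = (tug_alpha p CARD('n) / 2) ^ (2 * m) * (1 - (1 / 2) powr \<gamma>)"
  have m: "48 * (?n + p) \<le> real m * (p - ?n)"
    using real_nat_ceiling_ge[of "48 * (?n + p) / (p - ?n)"] assms unfolding m_def[symmetric]
    by (simp add: divide_le_eq)
  have \<gamma>: "\<gamma> > 0" unfolding \<gamma>_def using assms by (intro barrier_exponent_bounds) auto
  then have half: "(1 / 2) powr \<gamma> < (1::real)" using powr_less_mono2[of \<gamma> "1/2" 1] by simp
  have \<alpha>: "tug_alpha p CARD('n) > 0"
    unfolding tug_alpha_def using \<open>p > 2\<close> by (intro divide_pos_pos) (auto simp: add_nonneg_pos)
  have c: "c > 0" unfolding c_def using half \<alpha> by simp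
  have compare: "c * u y \<le> u x"
    if "bounded_domain \<Omega>" "\<epsilon> > 0" "p_harmonious p \<Omega> \<epsilon> u"
      and pos: "\<forall>x\<in>extended_domain \<Omega> \<epsilon>. u x > 0" and "\<rho> > 0" and sub: "ball z\<^sub>0 (5 * \<rho>) \<subseteq> \<Omega>"
      and xy: "x \<in> ball z\<^sub>0 \<rho>" "y \<in> ball z\<^sub>0 \<rho>"
    for \<Omega> :: "(real^'n) set" and \<epsilon> u z\<^sub>0 \<rho> x y
  proof -
    define \<kappa> where "\<kappa> = (tug_alpha p CARD('n) / 2) ^ (2 * m) * u y"
    have "open \<Omega>" using \<open>bounded_domain \<Omega>\<close> by (simp add: bounded_domain_def)
    have "ball y (4 * \<rho>) \<subseteq> ball z\<^sub>0 (5 * \<rho>)"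
      using xy(2) by (intro ball_subset_ball_iff[THEN iffD2]) (simp add: dist_commute)
    then have sub': "ball y (4 * \<rho>) \<subseteq> \<Omega>" using sub by simp
    have y: "y \<in> ball y (4 * \<rho>)" using \<open>\<rho> > 0\<close> by simp
    have "dist x y \<le> dist z\<^sub>0 x + dist z\<^sub>0 y" by (rule dist_triangle3)
    then have dist: "dist x y < 2 * \<rho>" using xy by simp
    have "y \<in> extended_domain \<Omega> \<epsilon>" using y sub' unfolding extended_domain_def by blast
    then have "u y > 0" using pos by blast
    then have "\<kappa> > 0" using \<alpha> by (simp add: \<kappa>_def)
    have near: "\<kappa> \<le> u z" if z: "z \<in> ball y (4 * \<rho>)" "(p - ?n) * dist z y < 48 * (?n + p) * \<epsilon>" for z
      unfolding \<kappa>_def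
    proof (rule p_harmonious_chain[where S = "ball y (4 * \<rho>)" and s = "\<epsilon> / 2"])
      have "48 * (?n + p) * \<epsilon> \<le> real m * (p - ?n) * \<epsilon>"
        using m \<open>\<epsilon> > 0\<close> by (intro mult_right_mono) auto
      then have "(p - ?n) * dist z y < (p - ?n) * (real m * \<epsilon>)" using z(2) by (simp add: mult_ac)
      then show "dist z y \<le> real (2 * m) * (\<epsilon> / 2)" using assms by simp
    qed (use that \<open>p_harmonious p \<Omega> \<epsilon> u\<close> \<open>\<epsilon> > 0\<close> assms pos sub' y in auto)
    \<comment> \<open>The barrier lives on the ball of radius \<open>4 \<rho>\<close> around \<open>y\<close>, and \<open>|x - y| < 2 \<rho>\<close>.\<close>
    have "c * u y = \<kappa> * (1 - (1 / 2) powr \<gamma>)" by (simp add: c_def \<kappa>_def)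
    also have "\<dots> \<le> \<kappa> * (1 - (dist x y / (4 * \<rho>)) powr \<gamma>)"
      using dist \<open>\<rho> > 0\<close> \<open>\<kappa> > 0\<close> \<gamma>
      by (intro mult_left_mono diff_left_mono powr_mono2) (auto simp: field_simps)
    also have "\<dots> \<le> u x"
      unfolding \<gamma>_def
    proof (rule p_harmonious_ge_power_barrier[OF \<open>open \<Omega>\<close> \<open>p_harmonious p \<Omega> \<epsilon> u\<close> assms \<open>\<epsilon> > 0\<close> _ sub'])
      show "x \<in> ball y (4 * \<rho>)" using dist \<open>\<rho> > 0\<close> by (simp add: dist_commute)
    qed (use pos near \<open>\<rho> > 0\<close> \<open>\<kappa> > 0\<close> in auto)
    finally show ?thesis .
  qed
  show ?thesis
  proof (intro exI[of _ "1 / c"] conjI allI impI)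
    show "1 / c > 0" using c by simp
    fix \<Omega> :: "(real^'n) set" and \<epsilon> u z\<^sub>0 \<rho>
    assume H: "bounded_domain \<Omega>" "\<epsilon> > 0" "p_harmonious p \<Omega> \<epsilon> u"
      "\<forall>x\<in>extended_domain \<Omega> \<epsilon>. u x > 0" "\<rho> > 0" "ball z\<^sub>0 (5 * \<rho>) \<subseteq> \<Omega>"
    have "(SUP y\<in>ball z\<^sub>0 \<rho>. u y) \<le> 1 / c * (INF x\<in>ball z\<^sub>0 \<rho>. u x)"
    proof (rule cSUP_least)
      fix y assume y: "y \<in> ball z\<^sub>0 \<rho>"
      have "c * u y \<le> (INF x\<in>ball z\<^sub>0 \<rho>. u x)"
        using compare[OF H _ y] \<open>\<rho> > 0\<close> by (intro cINF_greatest) auto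
      then show "u y \<le> 1 / c * (INF x\<in>ball z\<^sub>0 \<rho>. u x)"
        using c by (simp add: field_simps)
    qed (use \<open>\<rho> > 0\<close> in simp)
    then show "(SUP x\<in>ball z\<^sub>0 \<rho>. u x) \<le> 1 / c * (INF x\<in>ball z\<^sub>0 \<rho>. u x)" .
  qed
qed

end
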